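(* Let $R=\{(0,0),(0,1),(0,2),(3,0),(1,3),(2,1),(2,2),(2,3),(3,3)\}$ and $R'=\{(0,0),(1,0),(2,0),(0,3),(1,2),(2,2),(3,1),(3,2),(3,3)\}$. Then $(123,R)\sim_{jd}(132,R)$ and $(123,R')\sim_{jd}(132,R')$.
   Context: $S_n$ is the set of permutations $\pi=\pi_1\cdots\pi_n$ of $\{1,\dots,n\}$. A mesh pattern of length $k$ is a pair $(\tau,R)$ with $\tau\in S_k$ and $R\subseteq\{0,\dots,k\}\times\{0,\dots,k\}$ (the set of shaded boxes; box $(a,b)$ is the unit square with lower-left corner $(a,b)$). An occurrence of $(\tau,R)$ in $\pi\in S_n$ is a subsequence $\pi_{i_1}\cdots\pi_{i_k}$, $i_1<\dots<i_k$, order-isomorphic to $\tau$, such that, with $i_0=0$, $i_{k+1}=n+1$, with $v_1<\dots<v_k$ the values $\pi_{i_1},\dots,\pi_{i_k}$ in increasing order, and $v_0=0$, $v_{k+1}=n+1$, for each $(a,b)\in R$ there is no index $m$ with $i_a<m<i_{a+1}$ and $v_b<\pi_m<v_{b+1}$. Two mesh patterns $q_1,q_2$ are jointly equidistributed, written $q_1\sim_{jd}q_2$, if for all nonnegative integers $n,k,\ell$ the number of $\pi\in S_n$ with exactly $k$ occurrences of $q_1$ and $\ell$ occurrences of $q_2$ equals the number of $\pi\in S_n$ with exactly $\ell$ occurrences of $q_1$ and $k$ occurrences of $q_2$. *)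

theory Defs
  imports "HOL-Combinatorics.Multiset_Permutations"
begin

text \<open>
  Permutations of \<open>{1..n}\<close> are written in one-line notation, as the lists in
  \<^term>\<open>permutations_of_set {1..n}\<close>. List positions start at 0, whereas positions
  in a permutation start at 1, hence the shift in \<open>entry\<close>.
\<close>

definition entry :: "nat list \<Rightarrow> nat \<Rightarrow> nat" where
  "entry \<pi> m = \<pi> ! (m - 1)"

text \<open>
  A mesh pattern of length \<open>k\<close> is a pair \<open>(\<tau>, R)\<close>, where \<open>\<tau>\<close> is a permutation of
  \<open>{1..k}\<close> and \<open>R\<close> is the set of shaded boxes.
\<close>

type_synonym mesh_pattern = "nat list \<times> (nat \<times> nat) set"

definition is_mesh_pattern :: "mesh_pattern \<Rightarrow> bool" where
  "is_mesh_pattern q \<longleftrightarrow> (case q of (\<tau>, R) \<Rightarrow>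
     \<tau> \<in> permutations_of_set {1..length \<tau>} \<and> R \<subseteq> {0..length \<tau>} \<times> {0..length \<tau>})"

definition order_isomorphic :: "nat list \<Rightarrow> nat list \<Rightarrow> bool" where
  "order_isomorphic xs ys \<longleftrightarrow> length xs = length ys \<and>
     (\<forall>s<length xs. \<forall>t<length xs. xs ! s < xs ! t \<longleftrightarrow> ys ! s < ys ! t)"

text \<open>
  An occurrence is represented by its list of positions \<open>is = [i\<^sub>1, \<dots>, i\<^sub>k]\<close>. In the
  definition below, \<open>i ! a\<close> and \<open>v ! b\<close> are the grid lines \<open>i\<^sub>a\<close> and \<open>v\<^sub>b\<close>,
  including the boundary lines with indices \<open>0\<close> and \<open>k + 1\<close>.
\<close>

definition mesh_occurrence :: "mesh_pattern \<Rightarrow> nat list \<Rightarrow> nat list \<Rightarrow> bool" where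
  "mesh_occurrence q \<pi> is \<longleftrightarrow> (case q of (\<tau>, R) \<Rightarrow>
     let n = length \<pi>;
         vals = map (entry \<pi>) is;
         i = [0] @ is @ [n + 1];
         v = [0] @ sort vals @ [n + 1]
     in set is \<subseteq> {1..n} \<and> sorted_wrt (<) is \<and> order_isomorphic vals \<tau> \<and>
        (\<forall>(a, b)\<in>R. \<not> (\<exists>m. i ! a < m \<and> m < i ! (a + 1) \<and>
                              v ! b < entry \<pi> m \<and> entry \<pi> m < v ! (b + 1))))"

definition occ_count :: "mesh_pattern \<Rightarrow> nat list \<Rightarrow> nat" where
  "occ_count q \<pi> = card {is. mesh_occurrence q \<pi> is}"

definition jointly_equidistributed :: "mesh_pattern \<Rightarrow> mesh_pattern \<Rightarrow> bool"
    (infix "\<sim>\<^sub>j\<^sub>d" 50) where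
  "q1 \<sim>\<^sub>j\<^sub>d q2 \<longleftrightarrow> (\<forall>n k l.
     card {\<pi> \<in> permutations_of_set {1..n}. occ_count q1 \<pi> = k \<and> occ_count q2 \<pi> = l} =
     card {\<pi> \<in> permutations_of_set {1..n}. occ_count q1 \<pi> = l \<and> occ_count q2 \<pi> = k})"

end

theory Submission
  imports Defs
begin

text \<open>
  Exchanging the entries at the last two positions of an occurrence of \<open>(123, R)\<close> gives an
  occurrence of \<open>(132, R)\<close> at the same positions, and vice versa: the grid of the occurrence and all
  points off the grid are unchanged. Hence, for every shading \<open>R\<close>, both patterns have the same total
  number of occurrences over \<open>S\<^sub>n\<close>. For the two shadings of the theorem every permutation contains at
  most one occurrence of each pattern: the entries before the first point of an occurrence of
  \<open>(\<tau>, R)\<close> are exactly those exceeding its maximum, and the entries after the last point of an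
  occurrence of \<open>(\<tau>, R')\<close> are exactly those below its minimum, and a second
  occurrence would violate this or one of the remaining boxes. For statistics with values in \<open>{0, 1}\<close> equality of the
  totals already gives joint equidistribution.
\<close>

section \<open>Occurrences of 123 and 132 as triples of positions\<close>

text \<open>The shading clause of \<open>mesh_occurrence\<close>, separated out so that the grid
  lines \<open>i\<close> and \<open>v\<close> can be held fixed while the entries \<open>f\<close>
  vary. Entries form a function, so that the later uniqueness arguments are free of lists.\<close>

definition empty_boxes :: "(nat \<times> nat) set \<Rightarrow> (nat \<Rightarrow> nat) \<Rightarrow> nat list \<Rightarrow> nat list \<Rightarrow> bool" where
  "empty_boxes R f i v \<longleftrightarrow>
     (\<forall>(a, b)\<in>R. \<not> (\<exists>m. i ! a < m \<and> m < i ! (a + 1) \<and> v ! b < f m \<and> f m < v ! (b + 1)))"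

lemma empty_boxesD:
  assumes "empty_boxes R f i v" "(a, b) \<in> R" "i ! a < m" "m < i ! (a + 1)"
  shows "\<not> (v ! b < f m \<and> f m < v ! (b + 1))"
  using assms unfolding empty_boxes_def by blast

lemma order_isomorphic_123:
  "order_isomorphic xs [1, 2, 3] \<longleftrightarrow> (\<exists>x y z. xs = [x, y, z] \<and> x < y \<and> y < z)"
  unfolding order_isomorphic_def
  by (auto simp: length_Suc_conv less_Suc_eq)

lemma order_isomorphic_132:
  "order_isomorphic xs [1, 3, 2] \<longleftrightarrow> (\<exists>x y z. xs = [x, y, z] \<and> x < z \<and> z < y)"
  unfolding order_isomorphic_def
  by (auto simp: length_Suc_conv less_Suc_eq)

text \<open>The order of the three values is known here, so \<open>sort\<close> disappears and the
  horizontal grid lines become explicit.\<close>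

lemma mesh_occurrence_123_iff:
  "mesh_occurrence ([1, 2, 3], R) \<pi> is \<longleftrightarrow>
     (\<exists>i j k. is = [i, j, k] \<and> 0 < i \<and> i < j \<and> j < k \<and> k \<le> length \<pi> \<and>
        entry \<pi> i < entry \<pi> j \<and> entry \<pi> j < entry \<pi> k \<and>
        empty_boxes R (entry \<pi>) [0, i, j, k, length \<pi> + 1]
          [0, entry \<pi> i, entry \<pi> j, entry \<pi> k, length \<pi> + 1])"
proof (cases "\<exists>i j k. is = [i, j, k]")
  case True
  then obtain i j k where "is": "is = [i, j, k]" by blast
  have "sort [x, y, z] = [x, y, z]" if "x < y" "y < z" for x y z :: nat
    using that by simp
  then show ?thesis
    unfolding mesh_occurrence_def Let_def prod.case order_isomorphic_123
      empty_boxes_def[symmetric] "is"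
    by auto
next
  case False
  then show ?thesis
    unfolding mesh_occurrence_def Let_def prod.case order_isomorphic_123 map_eq_Cons_conv
    by blast
qed

text \<open>As for 123, except that sorting moves the value at the last position \<open>k\<close> in
  front of the value at \<open>j\<close>.\<close>

lemma mesh_occurrence_132_iff:
  "mesh_occurrence ([1, 3, 2], R) \<pi> is \<longleftrightarrow>
     (\<exists>i j k. is = [i, j, k] \<and> 0 < i \<and> i < j \<and> j < k \<and> k \<le> length \<pi> \<and>
        entry \<pi> i < entry \<pi> k \<and> entry \<pi> k < entry \<pi> j \<and>
        empty_boxes R (entry \<pi>) [0, i, j, k, length \<pi> + 1]
          [0, entry \<pi> i, entry \<pi> k, entry \<pi> j, length \<pi> + 1])"
proof (cases "\<exists>i j k. is = [i, j, k]")
  case True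
  then obtain i j k where "is": "is = [i, j, k]" by blast
  have "sort [x, y, z] = [x, z, y]" if "x < z" "z < y" for x y z :: nat
    using that by simp
  then show ?thesis
    unfolding mesh_occurrence_def Let_def prod.case order_isomorphic_132
      empty_boxes_def[symmetric] "is"
    by auto
next
  case False
  then show ?thesis
    unfolding mesh_occurrence_def Let_def prod.case order_isomorphic_132 map_eq_Cons_conv
    by blast
qed

lemma finite_mesh_occurrences: "finite {is. mesh_occurrence q \<pi> is}"
proof (rule finite_subset)
  show "{is. mesh_occurrence q \<pi> is} \<subseteq> {is. set is \<subseteq> {1..length \<pi>} \<and> distinct is}"
    unfolding mesh_occurrence_def Let_def strict_sorted_iff by (cases q) blast
qed (simp add: finite_subset_distinct)

section \<open>Exchanging two entries and the equality of the totals\<close>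

text \<open>Positions start at 1 and list indices at 0, hence the shifts. The nested updates have
  the shape expected by \<open>mset_swap\<close>.\<close>

definition swap_entries :: "nat \<Rightarrow> nat \<Rightarrow> nat list \<Rightarrow> nat list" where
  "swap_entries j k \<pi> = \<pi>[k - 1 := \<pi> ! (j - 1), j - 1 := \<pi> ! (k - 1)]"

lemma length_swap_entries [simp]: "length (swap_entries j k \<pi>) = length \<pi>"
  by (simp add: swap_entries_def)

lemma entry_swap_entries:
  assumes "0 < j" "j < k" "k \<le> length \<pi>" "0 < m"
  shows "entry (swap_entries j k \<pi>) m =
    (if m = j then entry \<pi> k else if m = k then entry \<pi> j else entry \<pi> m)"
  using assms by (auto simp: swap_entries_def entry_def nth_list_update)

lemma swap_entries_swap_entries:
  assumes "0 < j" "j < k" "k \<le> length \<pi>"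
  shows "swap_entries j k (swap_entries j k \<pi>) = \<pi>"
  using assms by (intro nth_equalityI) (auto simp: swap_entries_def nth_list_update)

lemma swap_entries_in_permutations_of_set:
  assumes "\<pi> \<in> permutations_of_set A" "0 < j" "j < k" "k \<le> length \<pi>"
  shows "swap_entries j k \<pi> \<in> permutations_of_set A"
proof -
  have "mset (swap_entries j k \<pi>) = mset \<pi>"
    unfolding swap_entries_def using assms by (intro mset_swap) auto
  then show ?thesis
    using assms(1) by (metis mset_eq_setD mset_eq_imp_distinct_iff permutations_of_setD
        permutations_of_setI)
qed

text \<open>A point in a box lies strictly between two neighbouring vertical grid lines. The swapped
  entries lie on such lines, so no point inside a box moves.\<close>

lemma empty_boxes_swap_entries:
  assumes "R \<subseteq> {0..3} \<times> {0..3}" "0 < i" "i < j" "j < k" "k \<le> length \<pi>"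
    and "empty_boxes R (entry \<pi>) [0, i, j, k, n] v"
  shows "empty_boxes R (entry (swap_entries j k \<pi>)) [0, i, j, k, n] v"
  unfolding empty_boxes_def
proof (clarify)
  fix a b m
  assume ab: "(a, b) \<in> R"
    and m: "[0, i, j, k, n] ! a < m" "m < [0, i, j, k, n] ! (a + 1)"
    and v: "v ! b < entry (swap_entries j k \<pi>) m" "entry (swap_entries j k \<pi>) m < v ! (b + 1)"
  \<comment> \<open>The bound on \<open>R\<close> keeps \<open>a + 1\<close> within the five
    vertical grid lines; beyond them \<open>!\<close> has no usable value.\<close>
  have "a \<in> {0, 1, 2, 3}"
    using ab assms(1) by auto
  then have "m \<noteq> j \<and> m \<noteq> k"
    using m assms(2-4) by auto
  then have "entry (swap_entries j k \<pi>) m = entry \<pi> m"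
    using m assms(2-5) by (subst entry_swap_entries) auto
  then show False
    using empty_boxesD[OF assms(6) ab m] v by simp
qed

text \<open>The swap turns the value order of 123 into that of 132 while the sorted list of the
  three values, and so the whole grid, stays fixed.\<close>

lemma mesh_occurrence_swap_entries_iff:
  assumes "R \<subseteq> {0..3} \<times> {0..3}" "0 < j" "j < k" "k \<le> length \<pi>"
  shows "mesh_occurrence ([1, 3, 2], R) (swap_entries j k \<pi>) [i, j, k] \<longleftrightarrow>
    mesh_occurrence ([1, 2, 3], R) \<pi> [i, j, k]"
proof -
  \<comment> \<open>One direction is the previous lemma for \<open>\<pi>\<close>, the other is the
    same lemma for the swapped list, as swapping is an involution.\<close>
  have "empty_boxes R (entry (swap_entries j k \<pi>)) [0, i, j, k, n] v \<longleftrightarrow>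
      empty_boxes R (entry \<pi>) [0, i, j, k, n] v" if "0 < i" "i < j" for n v
    using empty_boxes_swap_entries[OF assms(1) that assms(3,4)]
      empty_boxes_swap_entries[OF assms(1) that assms(3), of "swap_entries j k \<pi>"]
      assms(4) swap_entries_swap_entries[OF assms(2-4)]
    by auto
  then show ?thesis
    unfolding mesh_occurrence_123_iff mesh_occurrence_132_iff
    using assms(2-4) by (auto simp: entry_swap_entries)
qed

text \<open>Each total counts pairs of a permutation and an occurrence in it; swapping entries is a
  bijection between the two sets of pairs.\<close>

lemma sum_occ_count_123_132:
  assumes R: "R \<subseteq> {0..3} \<times> {0..3}"
  shows "(\<Sum>\<pi>\<in>permutations_of_set A. occ_count ([1, 2, 3], R) \<pi>) =
    (\<Sum>\<pi>\<in>permutations_of_set A. occ_count ([1, 3, 2], R) \<pi>)"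
proof -
  define occs where
    "occs \<tau> = (SIGMA \<pi>:permutations_of_set A. {is. mesh_occurrence (\<tau>, R) \<pi> is})" for \<tau>
  have sum: "(\<Sum>\<pi>\<in>permutations_of_set A. occ_count (\<tau>, R) \<pi>) = card (occs \<tau>)" for \<tau>
    unfolding occs_def occ_count_def
    by (subst card_SigmaI) (auto simp: finite_mesh_occurrences)
  \<comment> \<open>In \<open>[i, j, k]\<close> the indices 1 and 2 select \<open>j\<close> and
    \<open>k\<close>. The positions are kept, so \<open>F\<close> can read them off again and is its
    own inverse.\<close>
  define F where "F = (\<lambda>(\<pi>, is). (swap_entries (is ! 1) (is ! 2) \<pi>, is :: nat list))"
  have "bij_betw F (occs [1, 2, 3]) (occs [1, 3, 2])"
  proof (rule bij_betw_byWitness[where f' = F])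
    show "\<forall>x\<in>occs [1, 2, 3]. F (F x) = x"
      by (auto simp: occs_def F_def mesh_occurrence_123_iff swap_entries_swap_entries
          simp del: One_nat_def)
    show "\<forall>x\<in>occs [1, 3, 2]. F (F x) = x"
      by (auto simp: occs_def F_def mesh_occurrence_132_iff swap_entries_swap_entries
          simp del: One_nat_def)
    show "F ` occs [1, 2, 3] \<subseteq> occs [1, 3, 2]"
    proof (rule image_subsetI)
      fix p assume "p \<in> occs [1, 2, 3]"
      then obtain \<pi> "is" where p: "p = (\<pi>, is)"
        and occ: "mesh_occurrence ([1, 2, 3], R) \<pi> is"
        and \<pi>: "\<pi> \<in> permutations_of_set A"
        by (auto simp: occs_def)
      from occ obtain i j k where "is": "is = [i, j, k]" and "0 < i" "i < j" "j < k" "k \<le> length \<pi>"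
        unfolding mesh_occurrence_123_iff by blast
      then have jk: "0 < j" "j < k" "k \<le> length \<pi>" by auto
      show "F p \<in> occs [1, 3, 2]"
        using occ swap_entries_in_permutations_of_set[OF \<pi> jk]
          mesh_occurrence_swap_entries_iff[OF R jk]
        by (simp add: occs_def F_def p "is")
    qed
    show "F ` occs [1, 3, 2] \<subseteq> occs [1, 2, 3]"
    proof (rule image_subsetI)
      fix p assume "p \<in> occs [1, 3, 2]"
      then obtain \<pi> "is" where p: "p = (\<pi>, is)"
        and occ: "mesh_occurrence ([1, 3, 2], R) \<pi> is"
        and \<pi>: "\<pi> \<in> permutations_of_set A"
        by (auto simp: occs_def)
      from occ obtain i j k where "is": "is = [i, j, k]" and "0 < i" "i < j" "j < k" "k \<le> length \<pi>"
        unfolding mesh_occurrence_132_iff by blast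
      then have jk: "0 < j" "j < k" "k \<le> length \<pi>" by auto
      \<comment> \<open>The equivalence is used for the swapped permutation, whose swap is
        \<open>\<pi>\<close> again.\<close>
      show "F p \<in> occs [1, 2, 3]"
        using occ swap_entries_in_permutations_of_set[OF \<pi> jk] swap_entries_swap_entries[OF jk]
          mesh_occurrence_swap_entries_iff[OF R jk(1,2), of "swap_entries j k \<pi>"] jk(3)
        by (simp add: occs_def F_def p "is")
    qed
  qed
  then show ?thesis
    unfolding sum by (rule bij_betw_same_card)
qed

section \<open>From equal totals to joint equidistribution\<close>

text \<open>Each sum counts the points where its statistic is 1. Cancelling the points where both
  are 1 leaves equally many with values (1,0) and (0,1). The diagonal cases are trivial, and a value
  above 1 makes both sets empty.\<close>

lemma card_joint_swap_if_le_1: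
  fixes f g :: "'a \<Rightarrow> nat"
  assumes fin: "finite S" and f: "\<And>x. x \<in> S \<Longrightarrow> f x \<le> 1" and g: "\<And>x. x \<in> S \<Longrightarrow> g x \<le> 1"
    and sum: "sum f S = sum g S"
  shows "card {x \<in> S. f x = k \<and> g x = l} = card {x \<in> S. f x = l \<and> g x = k}"
proof -
  have eq: "card {x \<in> S. f x = 1 \<and> g x = 0} = card {x \<in> S. f x = 0 \<and> g x = 1}"
  proof -
    have card: "(\<Sum>x\<in>S. of_bool (P x)) = card {x \<in> S. P x}" for P
      using fin by (simp add: sum_of_bool_eq Int_def)
    have "sum f S = (\<Sum>x\<in>S. of_bool (f x = 1 \<and> g x = 0) + of_bool (f x = 1 \<and> g x = 1))"
      using f g by (intro sum.cong) (fastforce simp: le_Suc_eq)+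
    moreover have "sum g S = (\<Sum>x\<in>S. of_bool (f x = 0 \<and> g x = 1) + of_bool (f x = 1 \<and> g x = 1))"
      using f g by (intro sum.cong) (fastforce simp: le_Suc_eq)+
    ultimately show ?thesis
      using sum unfolding sum.distrib card by simp
  qed
  have *: "k \<le> 1 \<and> l \<le> 1" if "x \<in> S" "f x = k \<and> g x = l \<or> f x = l \<and> g x = k" for x
    using f[OF that(1)] g[OF that(1)] that(2) by auto
  show ?thesis
  proof (cases "k \<le> 1 \<and> l \<le> 1")
    case True
    then consider "k = l" | "k = 1" "l = 0" | "k = 0" "l = 1" by linarith
    then show ?thesis
      using eq by cases simp_all
  next
    case False
    then have "{x \<in> S. f x = k \<and> g x = l} = {}" "{x \<in> S. f x = l \<and> g x = k} = {}"
      using * by blast+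
    then show ?thesis by (simp only:)
  qed
qed

lemma jointly_equidistributed_123_132_if_le_1:
  assumes "R \<subseteq> {0..3} \<times> {0..3}"
    and "\<And>n \<pi>. \<pi> \<in> permutations_of_set {1..n} \<Longrightarrow> occ_count ([1, 2, 3], R) \<pi> \<le> 1"
    and "\<And>n \<pi>. \<pi> \<in> permutations_of_set {1..n} \<Longrightarrow> occ_count ([1, 3, 2], R) \<pi> \<le> 1"
  shows "([1, 2, 3], R) \<sim>\<^sub>j\<^sub>d ([1, 3, 2], R)"
  unfolding jointly_equidistributed_def
  using assms by (intro allI card_joint_swap_if_le_1 sum_occ_count_123_132) auto

lemma occ_count_le_1I:
  assumes "\<And>is js. mesh_occurrence q \<pi> is \<Longrightarrow> mesh_occurrence q \<pi> js \<Longrightarrow> is = js"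
  shows "occ_count q \<pi> \<le> 1"
  unfolding occ_count_def using assms
  by (intro card_le_Suc0_iff_eq[THEN iffD2, simplified One_nat_def[symmetric]])
    (auto simp: finite_mesh_occurrences)

section \<open>Permutations as injective functions on positions\<close>

lemma inj_on_entry:
  assumes "\<pi> \<in> permutations_of_set {1..n}"
  shows "inj_on (entry \<pi>) {1..n}"
proof (rule inj_onI)
  fix x y assume xy: "x \<in> {1..n}" "y \<in> {1..n}" "entry \<pi> x = entry \<pi> y"
  have "distinct \<pi>" "length \<pi> = n"
    using assms by (auto dest: permutations_of_setD simp: length_finite_permutations_of_set)
  then have "x - 1 = y - 1"
    using xy by (auto simp: entry_def nth_eq_iff_index_eq)
  then show "x = y" using xy by auto
qed

lemma entry_bounds:
  assumes "\<pi> \<in> permutations_of_set {1..n}" "0 < m" "m \<le> n"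
  shows "0 < entry \<pi> m" "entry \<pi> m < n + 1"
proof -
  have "length \<pi> = n"
    using assms by (auto simp: length_finite_permutations_of_set)
  then have "entry \<pi> m \<in> set \<pi>"
    using assms by (auto simp: entry_def)
  then show "0 < entry \<pi> m" "entry \<pi> m < n + 1"
    using assms by (auto dest: permutations_of_setD)
qed

text \<open>Boxes are open, so an empty box says nothing about points on its border. Injectivity
  keeps all other points off the horizontal grid lines.\<close>

lemma entry_off_grid:
  fixes i j k m n :: nat
  assumes "inj_on f {1..n}" "0 < i" "i < j" "j < k" "k \<le> n" "0 < m" "m \<le> n"
    and "m \<noteq> i" "m \<noteq> j" "m \<noteq> k"
  shows "f m \<noteq> f i" "f m \<noteq> f j" "f m \<noteq> f k"
  using assms by (auto simp: inj_on_eq_iff)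

section \<open>Uniqueness of occurrences for the shading \<open>R\<close>\<close>

text \<open>One predicate serves both patterns, since only the maximum of the last two values
  enters. The four quantified clauses come from column 0, the top row, column 2 and the box (3,0),
  in this order.\<close>

definition R_occurrence :: "nat \<Rightarrow> (nat \<Rightarrow> nat) \<Rightarrow> nat \<Rightarrow> nat \<Rightarrow> nat \<Rightarrow> bool" where
  "R_occurrence n f i j k \<longleftrightarrow>
     0 < i \<and> i < j \<and> j < k \<and> k \<le> n \<and> f i < f j \<and> f i < f k \<and>
     (\<forall>m. 0 < m \<and> m < i \<longrightarrow> max (f j) (f k) < f m) \<and>
     (\<forall>m. i < m \<and> m \<le> n \<longrightarrow> f m \<le> max (f j) (f k)) \<and>
     (\<forall>m. j < m \<and> m < k \<longrightarrow> f m < f i) \<and>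
     (\<forall>m. k < m \<and> m \<le> n \<longrightarrow> f i < f m)"

lemma R_occurrenceI:
  assumes inj: "inj_on f {1..n}" and pos: "\<And>m. 0 < m \<Longrightarrow> m \<le> n \<Longrightarrow> 0 < f m \<and> f m < n + 1"
    and ord: "0 < i" "i < j" "j < k" "k \<le> n" and min: "f i < f j" "f i < f k"
    and R: "R = {(0,0), (0,1), (0,2), (3,0), (1,3), (2,1), (2,2), (2,3), (3,3)}"
    and boxes: "empty_boxes R f [0, i, j, k, n + 1]
      [0, f i, min (f j) (f k), max (f j) (f k), n + 1]"
  shows "R_occurrence n f i j k"
proof -
  define y z where yz: "y = min (f j) (f k)" "z = max (f j) (f k)"
  have grid: "f i < y" "y \<le> z" "f j \<le> z" "f k \<le> z"  "f j = y \<or> f j = z" "f k = y \<or> f k = z"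
    using min unfolding yz by auto
  have off: "f m \<noteq> f i \<and> f m \<noteq> y \<and> f m \<noteq> z"
    if "0 < m" "m \<le> n" "m \<noteq> i" "m \<noteq> j" "m \<noteq> k" for m
    using entry_off_grid[OF inj ord that] unfolding yz by (auto simp: min_def max_def)
  note box = empty_boxesD[OF boxes[folded yz]]
  \<comment> \<open>Column 0 is shaded except for its top box. The same reasoning for column 2
    leaves only its bottom box in \<open>gap\<close>.\<close>
  have above_before: "z < f m" if "0 < m" "m < i" for m
    using box[of 0 0 m] box[of 0 1 m] box[of 0 2 m] off[of m] pos[of m] grid that ord
    by (simp add: R) linarith?
  \<comment> \<open>The inequality is weak because \<open>z\<close> is itself attained at
    \<open>j\<close> or \<open>k\<close>.\<close>
  have below_after: "f m \<le> z" if m: "i < m" "m \<le> n" for m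
  proof -
    consider "m = j" | "m = k" | "i < m" "m < j" | "j < m" "m < k" | "k < m"
      using m ord linorder_less_linear[of m i] linorder_less_linear[of m j]
        linorder_less_linear[of m k] by auto
    then show ?thesis
    proof cases
      case 1 then show ?thesis using grid by auto
    next
      case 2 then show ?thesis using grid by auto
    next
      case 3 then show ?thesis
        using box[of 1 3 m] off[of m] pos[of m] grid m ord
        by (simp add: R) linarith?
    next
      case 4 then show ?thesis
        using box[of 2 3 m] off[of m] pos[of m] grid m ord
        by (simp add: R) linarith?
    next
      case 5 then show ?thesis
        using box[of 3 3 m] off[of m] pos[of m] grid m ord
        by (simp add: R) linarith?
    qed
  qed
  have gap: "f m < f i" if "j < m" "m < k" for m
    using box[of 2 1 m] box[of 2 2 m] box[of 2 3 m] off[of m] pos[of m] grid that ord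
    by (simp add: R) linarith?
  have tail: "f i < f m" if "k < m" "m \<le> n" for m
    using box[of 3 0 m] off[of m] pos[of m] grid that ord
    by (simp add: R) linarith?
  show ?thesis
    unfolding R_occurrence_def yz[symmetric] using ord min above_before below_after gap tail by blast
qed

text \<open>If \<open>i < i'\<close>, then \<open>f i\<close> exceeds both \<open>f j'\<close> and
  \<open>f k'\<close>. This forces \<open>k\<close> to lie after \<open>k'\<close>, where entries
  are bounded by these two values, although \<open>f k\<close> exceeds \<open>f i\<close>.\<close>

lemma R_occurrence_first_ge:
  assumes "R_occurrence n f i j k" "R_occurrence n f i' j' k'"
  shows "i' \<le> i"
proof (rule ccontr)
  assume "\<not> i' \<le> i"
  then have "max (f j') (f k') < f i"
    using assms unfolding R_occurrence_def by auto
  then have "f k' < f i" by simp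
  \<comment> \<open>Entries at \<open>k\<close> and beyond exceed \<open>f i\<close>, so
    \<open>k'\<close> lies before \<open>k\<close>.\<close>
  then have "k' < k"
    using assms unfolding R_occurrence_def
    by (metis linorder_neqE_nat order.strict_trans order_less_irrefl less_imp_le_nat not_less)
  then have "f k \<le> max (f j') (f k')"
    using assms unfolding R_occurrence_def by auto
  then show False
    using assms \<open>max (f j') (f k') < f i\<close> unfolding R_occurrence_def by linarith
qed

text \<open>The hypothesis \<open>same\<close> says that both triples belong to the same pattern.
  The first positions agree, then the maxima and their positions; the remaining point is settled by
  the low entries between \<open>j\<close> and \<open>k\<close>.\<close>

lemma R_occurrence_unique:
  assumes inj: "inj_on f {1..n}"
    and occ: "R_occurrence n f i j k" "R_occurrence n f i' j' k'"
    and same: "f j < f k \<longleftrightarrow> f j' < f k'"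
  shows "i = i' \<and> j = j' \<and> k = k'"
proof -
  have i: "i' = i"
    using R_occurrence_first_ge occ by (meson le_antisym)
  have eq: "x = y" if "f x = f y" "0 < x" "x \<le> n" "0 < y" "y \<le> n" for x y
    using inj_onD[OF inj that(1)] that by auto
  have ord: "0 < j" "j < k" "k \<le> n" "0 < j'" "j' < k'" "k' \<le> n"
    using occ unfolding R_occurrence_def by auto
  \<comment> \<open>All four positions lie after the common first position, so each maximum bounds
    the values of the other occurrence.\<close>
  have "f j \<le> max (f j') (f k')" "f k \<le> max (f j') (f k')"
    "f j' \<le> max (f j) (f k)" "f k' \<le> max (f j) (f k)"
    using occ unfolding R_occurrence_def i by auto
  then have max: "max (f j) (f k) = max (f j') (f k')" by auto
  have gaps: "\<not> (j < m \<and> m < k)" "\<not> (j' < m \<and> m < k')" if "f i < f m" for m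
    using occ that unfolding R_occurrence_def i by (meson order.asym)+
  have above: "f i < f j" "f i < f k" "f i < f j'" "f i < f k'"
    using occ unfolding R_occurrence_def i by auto
  show ?thesis
  proof (cases "f j < f k")
    case True
    then have "k = k'" using max same ord eq[of k k'] by auto
    then show ?thesis
      using gaps[OF above(1)] gaps[OF above(3)] ord i by auto
  next
    case False
    then have "j = j'" using max same ord eq[of j j'] by auto
    then show ?thesis
      using gaps[OF above(2)] gaps[OF above(4)] ord i by auto
  qed
qed

section \<open>Uniqueness of occurrences for the shading \<open>R'\<close>\<close>

text \<open>The four quantified clauses come from column 3, the bottom row, row 2 and the box (0,3),
  in this order.\<close>

definition R'_occurrence :: "nat \<Rightarrow> (nat \<Rightarrow> nat) \<Rightarrow> nat \<Rightarrow> nat \<Rightarrow> nat \<Rightarrow> bool" where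
  "R'_occurrence n f i j k \<longleftrightarrow>
     0 < i \<and> i < j \<and> j < k \<and> k \<le> n \<and> f i < f j \<and> f i < f k \<and>
     (\<forall>m. k < m \<and> m \<le> n \<longrightarrow> f m < f i) \<and>
     (\<forall>m. 0 < m \<and> m \<le> k \<longrightarrow> f i \<le> f m) \<and>
     (\<forall>m. i < m \<and> m \<le> n \<longrightarrow> \<not> (min (f j) (f k) < f m \<and> f m < max (f j) (f k))) \<and>
     (\<forall>m. 0 < m \<and> m < i \<longrightarrow> f m \<le> max (f j) (f k))"

lemma R'_occurrenceI:
  assumes inj: "inj_on f {1..n}" and pos: "\<And>m. 0 < m \<Longrightarrow> m \<le> n \<Longrightarrow> 0 < f m \<and> f m < n + 1"
    and ord: "0 < i" "i < j" "j < k" "k \<le> n" and min: "f i < f j" "f i < f k"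
    and R: "R = {(0,0), (1,0), (2,0), (0,3), (1,2), (2,2), (3,1), (3,2), (3,3)}"
    and boxes: "empty_boxes R f [0, i, j, k, n + 1]
      [0, f i, min (f j) (f k), max (f j) (f k), n + 1]"
  shows "R'_occurrence n f i j k"
proof -
  define y z where yz: "y = min (f j) (f k)" "z = max (f j) (f k)"
  have grid: "f i < y" "y \<le> z" "f j \<le> z" "f k \<le> z"  "f j = y \<or> f j = z" "f k = y \<or> f k = z"
    using min unfolding yz by auto
  have off: "f m \<noteq> f i \<and> f m \<noteq> y \<and> f m \<noteq> z"
    if "0 < m" "m \<le> n" "m \<noteq> i" "m \<noteq> j" "m \<noteq> k" for m
    using entry_off_grid[OF inj ord that] unfolding yz by (auto simp: min_def max_def)
  note box = empty_boxesD[OF boxes[folded yz]]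
  have after: "f m < f i" if "k < m" "m \<le> n" for m
    using box[of 3 1 m] box[of 3 2 m] box[of 3 3 m] off[of m] pos[of m] grid that ord
    by (simp add: R) linarith?
  have before: "f i \<le> f m" if m: "0 < m" "m \<le> k" for m
  proof -
    consider "m = i" | "m = j" | "m = k" | "m < i" | "i < m" "m < j" | "j < m" "m < k"
      using m ord linorder_less_linear[of m i] linorder_less_linear[of m j]
        linorder_less_linear[of m k] by auto
    then show ?thesis
    proof cases
      case 1 then show ?thesis using grid by auto
    next
      case 2 then show ?thesis using grid by auto
    next
      case 3 then show ?thesis using grid by auto
    next
      case 4 then show ?thesis
        using box[of 0 0 m] off[of m] pos[of m] grid m ord
        by (simp add: R) linarith?
    next
      case 5 then show ?thesis
        using box[of 1 0 m] off[of m] pos[of m] grid m ord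
        by (simp add: R) linarith?
    next
      case 6 then show ?thesis
        using box[of 2 0 m] off[of m] pos[of m] grid m ord
        by (simp add: R) linarith?
    qed
  qed
  have gap: "\<not> (y < f m \<and> f m < z)" if m: "i < m" "m \<le> n" for m
  proof -
    consider "m = j" | "m = k" | "i < m" "m < j" | "j < m" "m < k" | "k < m"
      using m ord linorder_less_linear[of m i] linorder_less_linear[of m j]
        linorder_less_linear[of m k] by auto
    then show ?thesis
    proof cases
      case 1 then show ?thesis using grid by auto
    next
      case 2 then show ?thesis using grid by auto
    next
      case 3 then show ?thesis
        using box[of 1 2 m] off[of m] pos[of m] grid m ord
        by (simp add: R) linarith?
    next
      case 4 then show ?thesis
        using box[of 2 2 m] off[of m] pos[of m] grid m ord
        by (simp add: R) linarith?
    next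
      case 5 then show ?thesis
        using box[of 3 2 m] off[of m] pos[of m] grid m ord
        by (simp add: R) linarith?
    qed
  qed
  have start: "f m \<le> z" if "0 < m" "m < i" for m
    using box[of 0 3 m] off[of m] pos[of m] grid that ord
    by (simp add: R) linarith?
  show ?thesis
    unfolding R'_occurrence_def yz[symmetric] using ord min after before gap start by blast
qed

text \<open>If \<open>k < k'\<close>, the second occurrence lies entirely after \<open>k\<close> and
  below \<open>f i\<close>. Then the point at \<open>i\<close> is before \<open>i'\<close> and above
  both later values, which the box (0,3) forbids.\<close>

lemma R'_occurrence_last_ge:
  assumes "R'_occurrence n f i j k" "R'_occurrence n f i' j' k'"
  shows "k' \<le> k"
proof (rule ccontr)
  assume "\<not> k' \<le> k"
  then have "f k' < f i"
    using assms unfolding R'_occurrence_def by auto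
  then have "f i' < f i"
    using assms unfolding R'_occurrence_def by auto
  then have "k < i'"
    using assms unfolding R'_occurrence_def by (metis not_less)
  then have "f j' < f i" "i < i'" "0 < i"
    using assms unfolding R'_occurrence_def by auto
  moreover from this have "f i \<le> max (f j') (f k')"
    using assms unfolding R'_occurrence_def by auto
  ultimately show False
    using \<open>f k' < f i\<close> by auto
qed

text \<open>With the last position shared, the first one is where the minimum over positions up to
  \<open>k\<close> is attained. The middle value is then the neighbour of \<open>f k\<close>, on the
  side given by the pattern, among the entries after \<open>i\<close>.\<close>

lemma R'_occurrence_unique:
  assumes inj: "inj_on f {1..n}"
    and occ: "R'_occurrence n f i j k" "R'_occurrence n f i' j' k'"
    and same: "f j < f k \<longleftrightarrow> f j' < f k'"
  shows "i = i' \<and> j = j' \<and> k = k'"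
proof -
  have k: "k' = k"
    using R'_occurrence_last_ge occ by (meson le_antisym)
  have eq: "x = y" if "f x = f y" "0 < x" "x \<le> n" "0 < y" "y \<le> n" for x y
    using inj_onD[OF inj that(1)] that by auto
  have ord: "0 < i" "i < j" "j < k" "k \<le> n" "0 < i'" "i' < j'" "j' < k"
    using occ unfolding R'_occurrence_def k by auto
  have "f i \<le> f i'" "f i' \<le> f i"
    using occ ord unfolding R'_occurrence_def k by auto
  then have i: "i' = i"
    using ord eq[of i' i] by auto
  have "\<not> (min (f j) (f k) < f m \<and> f m < max (f j) (f k))" if "i < m" "m \<le> n" for m
    using occ(1) that unfolding R'_occurrence_def by blast
  moreover have "\<not> (min (f j') (f k) < f m \<and> f m < max (f j') (f k))" if "i < m" "m \<le> n" for m
    using occ(2) that unfolding R'_occurrence_def k i by blast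
  ultimately have gaps: "\<not> (min (f j) (f k) < f j' \<and> f j' < max (f j) (f k))"
    "\<not> (min (f j') (f k) < f j \<and> f j < max (f j') (f k))"
    using ord i by simp_all
  have ne: "f j \<noteq> f k" "f j' \<noteq> f k"
    using eq[of j k] eq[of j' k] ord by auto
  \<comment> \<open>Both values lie on the same side of \<open>f k\<close>; if they differed, the
    nearer one would lie strictly between \<open>f k\<close> and the farther one.\<close>
  have "f j = f j'"
    using gaps same ne unfolding k by (auto simp: min_def max_def split: if_splits)
  then have "j = j'"
    using ord eq[of j j'] by auto
  then show ?thesis
    using i k by simp
qed

section \<open>Back to mesh occurrences, and the conclusion\<close>

text \<open>The pattern decides which of the last two values is \<open>min\<close> and which is
  \<open>max\<close>. The extra comparison in the conclusions later discharges
  \<open>same\<close>.\<close>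

lemma R_occurrence_if_mesh_occurrence:
  assumes \<pi>: "\<pi> \<in> permutations_of_set {1..n}"
    and R: "R = {(0,0), (0,1), (0,2), (3,0), (1,3), (2,1), (2,2), (2,3), (3,3)}"
  shows "mesh_occurrence ([1, 2, 3], R) \<pi> [i, j, k] \<Longrightarrow>
      R_occurrence n (entry \<pi>) i j k \<and> entry \<pi> j < entry \<pi> k"
    and "mesh_occurrence ([1, 3, 2], R) \<pi> [i, j, k] \<Longrightarrow>
      R_occurrence n (entry \<pi>) i j k \<and> entry \<pi> k < entry \<pi> j"
proof -
  have n: "length \<pi> = n"
    using \<pi> by (auto simp: length_finite_permutations_of_set)
  have pos: "0 < entry \<pi> m \<and> entry \<pi> m < n + 1" if "0 < m" "m \<le> n" for m
    using entry_bounds[OF \<pi> that] by blast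
  show "R_occurrence n (entry \<pi>) i j k \<and> entry \<pi> j < entry \<pi> k"
    if "mesh_occurrence ([1, 2, 3], R) \<pi> [i, j, k]"
  proof -
    have ord: "0 < i" "i < j" "j < k" "k \<le> n"
      and vals: "entry \<pi> i < entry \<pi> j" "entry \<pi> j < entry \<pi> k"
      and boxes: "empty_boxes R (entry \<pi>) [0, i, j, k, n + 1]
        [0, entry \<pi> i, entry \<pi> j, entry \<pi> k, n + 1]"
      using that unfolding mesh_occurrence_123_iff n by blast+
    have "min (entry \<pi> j) (entry \<pi> k) = entry \<pi> j" "max (entry \<pi> j) (entry \<pi> k) = entry \<pi> k"
      using vals by auto
    then show ?thesis
      using R_occurrenceI[OF inj_on_entry[OF \<pi>] pos ord _ _ R] vals boxes by simp
  qed
  show "R_occurrence n (entry \<pi>) i j k \<and> entry \<pi> k < entry \<pi> j"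
    if "mesh_occurrence ([1, 3, 2], R) \<pi> [i, j, k]"
  proof -
    have ord: "0 < i" "i < j" "j < k" "k \<le> n"
      and vals: "entry \<pi> i < entry \<pi> k" "entry \<pi> k < entry \<pi> j"
      and boxes: "empty_boxes R (entry \<pi>) [0, i, j, k, n + 1]
        [0, entry \<pi> i, entry \<pi> k, entry \<pi> j, n + 1]"
      using that unfolding mesh_occurrence_132_iff n by blast+
    have "min (entry \<pi> j) (entry \<pi> k) = entry \<pi> k" "max (entry \<pi> j) (entry \<pi> k) = entry \<pi> j"
      using vals by auto
    then show ?thesis
      using R_occurrenceI[OF inj_on_entry[OF \<pi>] pos ord _ _ R] vals boxes by simp
  qed
qed

lemma R'_occurrence_if_mesh_occurrence:
  assumes \<pi>: "\<pi> \<in> permutations_of_set {1..n}"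
    and R: "R = {(0,0), (1,0), (2,0), (0,3), (1,2), (2,2), (3,1), (3,2), (3,3)}"
  shows "mesh_occurrence ([1, 2, 3], R) \<pi> [i, j, k] \<Longrightarrow>
      R'_occurrence n (entry \<pi>) i j k \<and> entry \<pi> j < entry \<pi> k"
    and "mesh_occurrence ([1, 3, 2], R) \<pi> [i, j, k] \<Longrightarrow>
      R'_occurrence n (entry \<pi>) i j k \<and> entry \<pi> k < entry \<pi> j"
proof -
  have n: "length \<pi> = n"
    using \<pi> by (auto simp: length_finite_permutations_of_set)
  have pos: "0 < entry \<pi> m \<and> entry \<pi> m < n + 1" if "0 < m" "m \<le> n" for m
    using entry_bounds[OF \<pi> that] by blast
  show "R'_occurrence n (entry \<pi>) i j k \<and> entry \<pi> j < entry \<pi> k"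
    if "mesh_occurrence ([1, 2, 3], R) \<pi> [i, j, k]"
  proof -
    have ord: "0 < i" "i < j" "j < k" "k \<le> n"
      and vals: "entry \<pi> i < entry \<pi> j" "entry \<pi> j < entry \<pi> k"
      and boxes: "empty_boxes R (entry \<pi>) [0, i, j, k, n + 1]
        [0, entry \<pi> i, entry \<pi> j, entry \<pi> k, n + 1]"
      using that unfolding mesh_occurrence_123_iff n by blast+
    have "min (entry \<pi> j) (entry \<pi> k) = entry \<pi> j" "max (entry \<pi> j) (entry \<pi> k) = entry \<pi> k"
      using vals by auto
    then show ?thesis
      using R'_occurrenceI[OF inj_on_entry[OF \<pi>] pos ord _ _ R] vals boxes by simp
  qed
  show "R'_occurrence n (entry \<pi>) i j k \<and> entry \<pi> k < entry \<pi> j"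
    if "mesh_occurrence ([1, 3, 2], R) \<pi> [i, j, k]"
  proof -
    have ord: "0 < i" "i < j" "j < k" "k \<le> n"
      and vals: "entry \<pi> i < entry \<pi> k" "entry \<pi> k < entry \<pi> j"
      and boxes: "empty_boxes R (entry \<pi>) [0, i, j, k, n + 1]
        [0, entry \<pi> i, entry \<pi> k, entry \<pi> j, n + 1]"
      using that unfolding mesh_occurrence_132_iff n by blast+
    have "min (entry \<pi> j) (entry \<pi> k) = entry \<pi> k" "max (entry \<pi> j) (entry \<pi> k) = entry \<pi> j"
      using vals by auto
    then show ?thesis
      using R'_occurrenceI[OF inj_on_entry[OF \<pi>] pos ord _ _ R] vals boxes by simp
  qed
qed

lemma occ_count_le_1_R:
  assumes \<pi>: "\<pi> \<in> permutations_of_set {1..n}"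
    and R: "R = {(0,0), (0,1), (0,2), (3,0), (1,3), (2,1), (2,2), (2,3), (3,3)}"
  shows "occ_count ([1, 2, 3], R) \<pi> \<le> 1" "occ_count ([1, 3, 2], R) \<pi> \<le> 1"
proof -
  note unique = R_occurrence_unique[OF inj_on_entry[OF \<pi>]]
  show "occ_count ([1, 2, 3], R) \<pi> \<le> 1"
  proof (rule occ_count_le_1I)
    fix "is" js
    assume occ: "mesh_occurrence ([1, 2, 3], R) \<pi> is" "mesh_occurrence ([1, 2, 3], R) \<pi> js"
    then obtain i j k i' j' k' where "is": "is = [i, j, k]" "js = [i', j', k']"
      unfolding mesh_occurrence_123_iff by blast
    show "is = js"
      using occ[unfolded "is", THEN R_occurrence_if_mesh_occurrence(1)[OF \<pi> R]]
        unique[of i j k i' j' k'] by (simp add: "is")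
  qed
  show "occ_count ([1, 3, 2], R) \<pi> \<le> 1"
  proof (rule occ_count_le_1I)
    fix "is" js
    assume occ: "mesh_occurrence ([1, 3, 2], R) \<pi> is" "mesh_occurrence ([1, 3, 2], R) \<pi> js"
    then obtain i j k i' j' k' where "is": "is = [i, j, k]" "js = [i', j', k']"
      unfolding mesh_occurrence_132_iff by blast
    show "is = js"
      using occ[unfolded "is", THEN R_occurrence_if_mesh_occurrence(2)[OF \<pi> R]]
        unique[of i j k i' j' k'] by (simp add: "is")
  qed
qed

lemma occ_count_le_1_R':
  assumes \<pi>: "\<pi> \<in> permutations_of_set {1..n}"
    and R: "R = {(0,0), (1,0), (2,0), (0,3), (1,2), (2,2), (3,1), (3,2), (3,3)}"
  shows "occ_count ([1, 2, 3], R) \<pi> \<le> 1" "occ_count ([1, 3, 2], R) \<pi> \<le> 1"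
proof -
  note unique = R'_occurrence_unique[OF inj_on_entry[OF \<pi>]]
  show "occ_count ([1, 2, 3], R) \<pi> \<le> 1"
  proof (rule occ_count_le_1I)
    fix "is" js
    assume occ: "mesh_occurrence ([1, 2, 3], R) \<pi> is" "mesh_occurrence ([1, 2, 3], R) \<pi> js"
    then obtain i j k i' j' k' where "is": "is = [i, j, k]" "js = [i', j', k']"
      unfolding mesh_occurrence_123_iff by blast
    show "is = js"
      using occ[unfolded "is", THEN R'_occurrence_if_mesh_occurrence(1)[OF \<pi> R]]
        unique[of i j k i' j' k'] by (simp add: "is")
  qed
  show "occ_count ([1, 3, 2], R) \<pi> \<le> 1"
  proof (rule occ_count_le_1I)
    fix "is" js
    assume occ: "mesh_occurrence ([1, 3, 2], R) \<pi> is" "mesh_occurrence ([1, 3, 2], R) \<pi> js"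
    then obtain i j k i' j' k' where "is": "is = [i, j, k]" "js = [i', j', k']"
      unfolding mesh_occurrence_132_iff by blast
    show "is = js"
      using occ[unfolded "is", THEN R'_occurrence_if_mesh_occurrence(2)[OF \<pi> R]]
        unique[of i j k i' j' k'] by (simp add: "is")
  qed
qed

theorem theorem3p2:
  fixes R R' :: "(nat \<times> nat) set"
  assumes "R = {(0,0), (0,1), (0,2), (3,0), (1,3), (2,1), (2,2), (2,3), (3,3)}"
    and "R' = {(0,0), (1,0), (2,0), (0,3), (1,2), (2,2), (3,1), (3,2), (3,3)}"
  shows "([1, 2, 3], R) \<sim>\<^sub>j\<^sub>d ([1, 3, 2], R) \<and> ([1, 2, 3], R') \<sim>\<^sub>j\<^sub>d ([1, 3, 2], R')"
proof
  show "([1, 2, 3], R) \<sim>\<^sub>j\<^sub>d ([1, 3, 2], R)"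
    by (rule jointly_equidistributed_123_132_if_le_1) (use assms(1) occ_count_le_1_R in auto)
  show "([1, 2, 3], R') \<sim>\<^sub>j\<^sub>d ([1, 3, 2], R')"
    by (rule jointly_equidistributed_123_132_if_le_1) (use assms(2) occ_count_le_1_R' in auto)
qed

end
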